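(* Let $H$ be a complex Hilbert space, and let $L$ be a locally compact Hausdorff space whose topology is denoted by $\tau$. Suppose $D$ is a $^*$-derivation on $C_0(L,B(H))$. Then there exists a (bounded) mapping $Z_0:L\to B(H)$ which is $\tau$-to-$\sigma(B(H),B(H)_* )$ continuous, with $\|Z_0\|\leq\|D\|$, $Z_0(t)^*=-Z_0(t)$ for every $t\in L$, and $D(X)=[Z_0,X]$ for every $X\in C_0(L,B(H))$. If $D$ is a general derivation on $C_0(L,B(H))$, then there exists a bounded function $Z_0:L\to B(H)$ which is $\tau$-to-$\sigma(B(H),B(H)_* )$ continuous, with $\|Z_0\|\leq2\|D\|$ and $D(X)=[Z_0,X]$ for every $X\in C_0(L,B(H))$.
   Context: $B(H)$ is the algebra of bounded operators on $H$ and $\sigma(B(H),B(H)_* )$ is its weak$^*$ (ultraweak) topology. $C_0(L,B(H))$ is the C$^*$-algebra of all norm-continuous functions $L\to B(H)$ vanishing at infinity, with pointwise operations and the supremum norm. $\|Z_0\|=\sup_{t\in L}\|Z_0(t)\|$ and $[Z_0,X](t)=Z_0(t)X(t)-X(t)Z_0(t)$. A derivation on a C$^*$-algebra $B$ is a linear map $D:B\to B$ with $D(ab)=D(a)b+aD(b)$ for all $a,b\in B$ (automatically bounded); it is a $^*$-derivation if moreover $D(a^* )=D(a)^*$ for all $a$. *)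

theory Defs
  imports "HOL-Analysis.Analysis"
begin

section \<open>Complex Hilbert spaces\<close>

text \<open>Norm, metric and topology are those of \<^class>\<open>real_normed_vector\<close>; the real scaling is
  required to be the restriction of the complex one.\<close>

class complex_vector = real_vector +
  fixes scaleC :: "complex \<Rightarrow> 'a \<Rightarrow> 'a"  (infixr "*\<^sub>C" 75)
  assumes scaleC_add_right: "c *\<^sub>C (x + y) = c *\<^sub>C x + c *\<^sub>C y"
    and scaleC_add_left: "(c + d) *\<^sub>C x = c *\<^sub>C x + d *\<^sub>C x"
    and scaleC_scaleC: "c *\<^sub>C (d *\<^sub>C x) = (c * d) *\<^sub>C x"
    and scaleC_one: "1 *\<^sub>C x = x"
    and scaleR_scaleC: "r *\<^sub>R x = complex_of_real r *\<^sub>C x"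

text \<open>The inner product is conjugate-linear in its first argument and linear in its second.\<close>

class complex_inner = complex_vector + real_normed_vector +
  fixes cinner :: "'a \<Rightarrow> 'a \<Rightarrow> complex"
  assumes cinner_commute: "cinner x y = cnj (cinner y x)"
    and cinner_add_right: "cinner x (y + z) = cinner x y + cinner x z"
    and cinner_scaleC_right: "cinner x (c *\<^sub>C y) = c * cinner x y"
    and cinner_ge_zero: "0 \<le> Re (cinner x x)"
    and cinner_eq_zero_iff: "cinner x x = 0 \<longleftrightarrow> x = 0"
    and norm_eq_sqrt_cinner: "norm x = sqrt (Re (cinner x x))"

class complex_hilbert_space = complex_inner + complete_space

lemma cinner_self: "cinner x x = complex_of_real ((norm x)\<^sup>2)" for x :: "'a::complex_inner"
proof -
  have "Im (cinner x x) = 0"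
    using arg_cong[OF cinner_commute[of x x], of Im] by simp
  then show ?thesis
    by (simp add: complex_eq_iff norm_eq_sqrt_cinner cinner_ge_zero)
qed

lemma norm_scaleC: "norm (c *\<^sub>C x) = cmod c * norm x" for x :: "'a::complex_inner"
proof -
  have "cinner (c *\<^sub>C x) (c *\<^sub>C x) = c * cnj (cinner x (c *\<^sub>C x))"
    by (metis cinner_commute cinner_scaleC_right)
  also have "\<dots> = (c * cnj c) * cinner x x"
    by (simp add: cinner_scaleC_right mult.assoc flip: cinner_commute)
  also have "\<dots> = complex_of_real ((cmod c * norm x)\<^sup>2)"
    by (simp add: cinner_self complex_norm_square power_mult_distrib del: of_real_power)
  finally have "(norm (c *\<^sub>C x))\<^sup>2 = (cmod c * norm x)\<^sup>2"
    by (simp only: cinner_self of_real_eq_iff)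
  then show ?thesis
    by (simp add: power2_eq_iff_nonneg)
qed

lemma bounded_linear_scaleC_right: "bounded_linear (\<lambda>x::'a::complex_inner. c *\<^sub>C x)"
proof (rule bounded_linear_intro[where K = "cmod c"])
  show "c *\<^sub>C (r *\<^sub>R x) = r *\<^sub>R (c *\<^sub>C x)" for r and x :: 'a
    by (simp add: scaleR_scaleC scaleC_scaleC mult.commute)
qed (simp_all add: scaleC_add_right norm_scaleC mult.commute)

section \<open>The algebra \<open>B(H)\<close>\<close>

typedef (overloaded) 'h bop =
  "{f :: 'h::complex_hilbert_space \<Rightarrow> 'h. bounded_linear f \<and> (\<forall>c x. f (c *\<^sub>C x) = c *\<^sub>C f x)}"
  morphisms bop_apply Bop
proof
  show "(\<lambda>x. x) \<in> {f :: 'h \<Rightarrow> 'h. bounded_linear f \<and> (\<forall>c x. f (c *\<^sub>C x) = c *\<^sub>C f x)}"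
    by (simp add: bounded_linear_ident)
qed

setup_lifting type_definition_bop

lemma scaleC_zero_right: "c *\<^sub>C 0 = (0 :: 'a::complex_vector)"
  using scaleC_add_right[of c "0::'a" 0] by simp

lemma scaleC_minus_right: "c *\<^sub>C (- x) = - (c *\<^sub>C x)" for x :: "'a::complex_vector"
  using scaleC_add_right[of c "- x" x]
  by (simp add: scaleC_zero_right eq_neg_iff_add_eq_0)

lemma scaleC_diff_right: "c *\<^sub>C (x - y) = c *\<^sub>C x - c *\<^sub>C y" for x :: "'a::complex_vector"
  using scaleC_add_right[of c x "- y"] by (simp add: scaleC_minus_right)

instantiation bop :: (complex_hilbert_space) real_normed_algebra
begin

lift_definition norm_bop :: "'a bop \<Rightarrow> real" is onorm .

lift_definition plus_bop :: "'a bop \<Rightarrow> 'a bop \<Rightarrow> 'a bop" is "\<lambda>f g x. f x + g x"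
  by (simp add: bounded_linear_add scaleC_add_right)

lift_definition minus_bop :: "'a bop \<Rightarrow> 'a bop \<Rightarrow> 'a bop" is "\<lambda>f g x. f x - g x"
  by (simp add: bounded_linear_sub scaleC_diff_right)

lift_definition uminus_bop :: "'a bop \<Rightarrow> 'a bop" is "\<lambda>f x. - f x"
  by (simp add: bounded_linear_minus scaleC_minus_right)

lift_definition zero_bop :: "'a bop" is "\<lambda>x. 0"
  by (simp add: bounded_linear_zero scaleC_zero_right)

lift_definition times_bop :: "'a bop \<Rightarrow> 'a bop \<Rightarrow> 'a bop" is "\<lambda>f g x. f (g x)"
  by (simp add: bounded_linear_compose)

lift_definition scaleR_bop :: "real \<Rightarrow> 'a bop \<Rightarrow> 'a bop" is "\<lambda>r f x. r *\<^sub>R f x"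
  by (auto intro: bounded_linear_const_scaleR) (simp add: scaleR_scaleC scaleC_scaleC mult.commute)

definition dist_bop :: "'a bop \<Rightarrow> 'a bop \<Rightarrow> real"
  where "dist_bop S T = norm (S - T)"

definition [code del]:
  "(uniformity :: ('a bop \<times> 'a bop) filter) = (INF e\<in>{0 <..}. principal {(S, T). dist S T < e})"

definition open_bop :: "'a bop set \<Rightarrow> bool"
  where [code del]: "open_bop U = (\<forall>S\<in>U. \<forall>\<^sub>F (S', T) in uniformity. S' = S \<longrightarrow> T \<in> U)"

definition sgn_bop :: "'a bop \<Rightarrow> 'a bop"
  where "sgn_bop T = inverse (norm T) *\<^sub>R T"

instance
proof
  fix R S T :: "'a bop" and a b :: real
  show "dist S T = norm (S - T)"
    by (rule dist_bop_def)
  show "sgn S = inverse (norm S) *\<^sub>R S"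
    by (rule sgn_bop_def)
  show "(uniformity :: ('a bop \<times> 'a bop) filter) = (INF e\<in>{0 <..}. principal {(S, T). dist S T < e})"
    by (rule uniformity_bop_def)
  show "open U = (\<forall>S\<in>U. \<forall>\<^sub>F (S', T) in uniformity. S' = S \<longrightarrow> T \<in> U)" for U :: "'a bop set"
    by (rule open_bop_def)
  show "norm S = 0 \<longleftrightarrow> S = 0"
    by transfer (auto simp: onorm_eq_0)
  show "norm (S + T) \<le> norm S + norm T"
    by transfer (simp add: onorm_triangle)
  show "norm (a *\<^sub>R S) = \<bar>a\<bar> * norm S"
    by transfer (simp add: onorm_scaleR)
  show "norm (S * T) \<le> norm S * norm T"
    by transfer (use onorm_compose in \<open>auto simp: o_def\<close>)
  show "R * (S + T) = R * S + R * T"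
    by transfer (auto simp: linear_simps)
  show "R * a *\<^sub>R S = a *\<^sub>R (R * S)"
    by transfer (auto simp: linear_simps)
qed (transfer; force simp: algebra_simps)+

end

instantiation bop :: (complex_hilbert_space) complex_vector
begin

lift_definition scaleC_bop :: "complex \<Rightarrow> 'a bop \<Rightarrow> 'a bop" is "\<lambda>c f x. c *\<^sub>C f x"
  by (auto intro: bounded_linear_compose[OF bounded_linear_scaleC_right]
      simp: scaleC_scaleC mult.commute)

instance
  by standard
    (transfer; simp add: scaleC_add_right scaleC_add_left scaleC_scaleC scaleC_one scaleR_scaleC)+

end

definition adjoint_bop :: "'h::complex_hilbert_space bop \<Rightarrow> 'h bop"
  where "adjoint_bop T = (THE S. \<forall>x y. cinner (bop_apply T x) y = cinner x (bop_apply S y))"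

text \<open>The predual \<open>B(H)\<^sub>*\<close>, as a space of functionals on \<open>B(H)\<close>: the functionals
  \<open>T \<mapsto> \<Sum>n. \<langle>x\<^sub>n, T y\<^sub>n\<rangle>\<close> with square-summable \<open>(x\<^sub>n)\<close> and \<open>(y\<^sub>n)\<close>.
  Sequences suffice for non-separable \<open>H\<close> as well.\<close>

definition bop_predual :: "('h::complex_hilbert_space bop \<Rightarrow> complex) set"
  where "bop_predual =
    {\<lambda>T. \<Sum>n. cinner (x n) (bop_apply T (y n)) | x y :: nat \<Rightarrow> 'h.
      summable (\<lambda>n. (norm (x n))\<^sup>2) \<and> summable (\<lambda>n. (norm (y n))\<^sup>2)}"

text \<open>\<open>\<sigma>(B(H), B(H)\<^sub>*)\<close>: the coarsest topology making all functionals in the predual continuous.\<close>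

definition ultraweak_topology :: "'h::complex_hilbert_space bop topology"
  where "ultraweak_topology = topology_generated_by {\<phi> -` U | \<phi> U. \<phi> \<in> bop_predual \<and> open U}"

section \<open>Derivations on \<open>C\<^sub>0(L, B(H))\<close>\<close>

definition C0 :: "('l::topological_space \<Rightarrow> 'h::complex_hilbert_space bop) set"
  where "C0 = {X. continuous_on UNIV X \<and>
    (\<forall>e>0. \<exists>K. compact K \<and> (\<forall>t. t \<notin> K \<longrightarrow> norm (X t) < e))}"

definition sup_norm :: "('l \<Rightarrow> 'h::complex_hilbert_space bop) \<Rightarrow> real"
  where "sup_norm X = (SUP t. norm (X t))"

definition derivation_C0 ::
    "(('l::topological_space \<Rightarrow> 'h::complex_hilbert_space bop) \<Rightarrow> ('l \<Rightarrow> 'h bop)) \<Rightarrow> bool"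
  where "derivation_C0 D \<longleftrightarrow>
    (\<forall>X\<in>C0. D X \<in> C0) \<and>
    (\<forall>X\<in>C0. \<forall>Y\<in>C0. D (\<lambda>t. X t + Y t) = (\<lambda>t. D X t + D Y t)) \<and>
    (\<forall>c. \<forall>X\<in>C0. D (\<lambda>t. c *\<^sub>C X t) = (\<lambda>t. c *\<^sub>C D X t)) \<and>
    (\<forall>X\<in>C0. \<forall>Y\<in>C0. D (\<lambda>t. X t * Y t) = (\<lambda>t. D X t * Y t + X t * D Y t))"

definition star_derivation_C0 ::
    "(('l::topological_space \<Rightarrow> 'h::complex_hilbert_space bop) \<Rightarrow> ('l \<Rightarrow> 'h bop)) \<Rightarrow> bool"
  where "star_derivation_C0 D \<longleftrightarrow> derivation_C0 D \<and>
    (\<forall>X\<in>C0. D (\<lambda>t. adjoint_bop (X t)) = (\<lambda>t. adjoint_bop (D X t)))"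

text \<open>The supremum is a genuine one for derivations, since these are automatically bounded.\<close>

definition op_norm_C0 ::
    "(('l::topological_space \<Rightarrow> 'h::complex_hilbert_space bop) \<Rightarrow> ('l \<Rightarrow> 'h bop)) \<Rightarrow> real"
  where "op_norm_C0 D = (SUP X\<in>{X \<in> C0. sup_norm X \<le> 1}. sup_norm (D X))"

end

theory Submission
  imports Defs
begin

text \<open>Fix a unit vector \<open>\<xi>\<close>. As \<open>X = \<parallel>X(\<cdot>)\<parallel>\<^sup>1\<^sup>/\<^sup>2 Y\<close> with both factors in \<open>C\<^sub>0\<close>, the value \<open>D X t\<close> depends
  only on \<open>X t\<close>, so \<open>D\<close> induces a derivation \<open>\<delta>\<^sub>t\<close> of \<open>B(H)\<close> for each \<open>t\<close>. The operator
  \<open>Z t x = \<delta>\<^sub>t (x \<otimes> \<xi>\<^sup>*) \<xi>\<close> implements \<open>\<delta>\<^sub>t\<close>: apply \<open>\<delta>\<^sub>t\<close> to \<open>T (x \<otimes> \<xi>\<^sup>*)\<close> and evaluate at \<open>\<xi>\<close>.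
  That \<open>D\<close> is bounded follows from the uniform boundedness principle
  on \<open>H\<close>: each \<open>\<langle>y, Z t \<cdot>\<rangle>\<close> is a bounded functional, and \<open>\<parallel>Z t x\<parallel>\<close> is bounded in \<open>t\<close> by a gliding
  hump. Then \<open>\<parallel>Z t\<parallel> \<le> \<parallel>D\<parallel>\<close>, and \<open>t \<mapsto> Z t\<close> is even strongly continuous. For a \<open>\<^sup>*\<close>-derivation,
  \<open>(Z t - (Z t)\<^sup>*) / 2\<close> implements \<open>D\<close> as well.\<close>

section \<open>Complex Hilbert spaces\<close>

lemma cinner_add_left: "cinner (x + y) z = cinner x z + cinner y z" for x :: "'a::complex_inner"
  by (metis cinner_add_right cinner_commute complex_cnj_add)

lemma cinner_scaleC_left: "cinner (c *\<^sub>C x) y = cnj c * cinner x y" for x :: "'a::complex_inner"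
  by (metis cinner_commute cinner_scaleC_right complex_cnj_mult)

lemma cinner_zero_right [simp]: "cinner x 0 = 0" for x :: "'a::complex_inner"
  using cinner_add_right[of x 0 0] by simp

lemma cinner_zero_left [simp]: "cinner 0 x = 0" for x :: "'a::complex_inner"
  using cinner_add_left[of 0 0 x] by simp

lemma cinner_minus_right: "cinner x (- y) = - cinner x y" for x :: "'a::complex_inner"
  using cinner_add_right[of x y "- y"] by (simp add: eq_neg_iff_add_eq_0 add.commute)

lemma cinner_minus_left: "cinner (- x) y = - cinner x y" for x :: "'a::complex_inner"
  using cinner_add_left[of x "- x" y] by (simp add: eq_neg_iff_add_eq_0 add.commute)

lemma cinner_diff_right: "cinner x (y - z) = cinner x y - cinner x z" for x :: "'a::complex_inner"
  using cinner_add_right[of x y "- z"] by (simp add: cinner_minus_right)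

lemma cinner_diff_left: "cinner (x - y) z = cinner x z - cinner y z" for x :: "'a::complex_inner"
  using cinner_add_left[of x "- y" z] by (simp add: cinner_minus_left)

lemma cinner_scaleR_right: "cinner x (r *\<^sub>R y) = of_real r * cinner x y" for x :: "'a::complex_inner"
  by (simp add: scaleR_scaleC cinner_scaleC_right)

lemma cinner_scaleR_left: "cinner (r *\<^sub>R x) y = of_real r * cinner x y" for x :: "'a::complex_inner"
  by (simp add: scaleR_scaleC cinner_scaleC_left)

lemma cinner_ext: "x = y" if "\<And>z. cinner z x = cinner z y" for x :: "'a::complex_inner"
proof -
  have "cinner (x - y) (x - y) = 0"
    using that by (simp add: cinner_diff_right)
  then show ?thesis
    by (simp add: cinner_eq_zero_iff)
qed

lemma norm_add_sqr: "(norm (x + y))\<^sup>2 = (norm x)\<^sup>2 + 2 * Re (cinner x y) + (norm y)\<^sup>2"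
  for x :: "'a::complex_inner"
proof -
  have "complex_of_real ((norm (x + y))\<^sup>2) = cinner (x + y) (x + y)"
    by (simp only: cinner_self)
  also have "\<dots> = cinner x x + (cinner x y + cnj (cinner x y)) + cinner y y"
    by (simp add: cinner_add_left cinner_add_right flip: cinner_commute)
  also have "\<dots> = complex_of_real ((norm x)\<^sup>2 + 2 * Re (cinner x y) + (norm y)\<^sup>2)"
    by (simp add: cinner_self complex_add_cnj)
  finally show ?thesis
    by (simp only: of_real_eq_iff)
qed

lemma parallelogram: "(norm (x + y))\<^sup>2 + (norm (x - y))\<^sup>2 = 2 * (norm x)\<^sup>2 + 2 * (norm y)\<^sup>2"
  for x :: "'a::complex_inner"
  using norm_add_sqr[of x y] norm_add_sqr[of x "- y"] by (simp add: cinner_minus_right)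

lemma norm_cinner_le: "norm (cinner x y) \<le> norm x * norm y" for x :: "'a::complex_inner"
proof (cases "x = 0 \<or> cinner x y = 0")
  case False
  define c where "c = cinner x y / of_real ((norm x)\<^sup>2)"
  have "0 \<le> (norm (y + (- c) *\<^sub>C x))\<^sup>2"
    by simp
  also have "\<dots> = (norm y)\<^sup>2 + 2 * Re (- c * cnj (cinner x y)) + (cmod c * norm x)\<^sup>2"
    by (simp add: norm_add_sqr cinner_scaleC_right norm_scaleC flip: cinner_commute)
  also have "Re (- c * cnj (cinner x y)) = - ((cmod (cinner x y))\<^sup>2 / (norm x)\<^sup>2)"
    by (simp only: cmod_power2) (simp add: c_def power2_eq_square add_divide_distrib)
  also have "(cmod c * norm x)\<^sup>2 = (cmod (cinner x y))\<^sup>2 / (norm x)\<^sup>2"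
    using False by (simp add: c_def norm_divide power_divide power_mult_distrib field_simps norm_power)
  finally have "(cmod (cinner x y))\<^sup>2 / (norm x)\<^sup>2 \<le> (norm y)\<^sup>2"
    by simp
  then have "(cmod (cinner x y))\<^sup>2 \<le> (norm x * norm y)\<^sup>2"
    using False by (simp add: field_simps power_mult_distrib)
  then show ?thesis
    by (simp add: power2_le_iff_abs_le)
qed auto

lemma bounded_linear_cinner_right: "bounded_linear (cinner (x :: 'a::complex_inner))"
proof (rule bounded_linear_intro[where K = "norm x"])
  show "norm (cinner x y) \<le> norm y * norm x" for y
    using norm_cinner_le[of x y] by (simp add: mult.commute)
qed (simp_all add: cinner_add_right cinner_scaleR_right scaleR_conv_of_real)

lemma bounded_linear_cinner_left: "bounded_linear (\<lambda>y. cinner y (x :: 'a::complex_inner))"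
proof (rule bounded_linear_intro[where K = "norm x"])
  show "norm (cinner y x) \<le> norm y * norm x" for y
    using norm_cinner_le[of y x] by simp
qed (simp_all add: cinner_add_left cinner_scaleR_left scaleR_conv_of_real)

lemma norm_le_if_cinner_le:
  fixes x :: "'a::complex_inner"
  assumes "\<And>y. norm y \<le> 1 \<Longrightarrow> norm (cinner y x) \<le> C"
  shows "norm x \<le> C"
proof (cases "x = 0")
  case True
  then show ?thesis using assms[of 0] by simp
next
  case False
  then have "norm (cinner (inverse (norm x) *\<^sub>R x) x) = norm x"
    by (simp add: cinner_scaleR_left cinner_self norm_mult norm_inverse power2_eq_square
        del: of_real_inverse of_real_mult of_real_power)
  with assms[of "inverse (norm x) *\<^sub>R x"] False show ?thesis by simp
qed

text \<open>The representing vector is the minimiser of \<open>\<parallel>x\<parallel>\<^sup>2 - 2 Re (f x)\<close>.\<close>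

lemma riesz_representation:
  fixes f :: "'h::complex_hilbert_space \<Rightarrow> complex"
  assumes f: "bounded_linear f" and fC: "\<And>c x. f (c *\<^sub>C x) = c * f x"
  shows "\<exists>u. \<forall>x. f x = cinner u x"
proof -
  interpret bounded_linear f by (rule f)
  obtain K where K: "\<And>x. norm (f x) \<le> norm x * K"
    using bounded by blast
  define q where "q x = (norm x)\<^sup>2 - 2 * Re (f x)" for x
  have q_ge: "- K\<^sup>2 \<le> q x" for x
  proof -
    have "0 \<le> (norm x - K)\<^sup>2" by simp
    moreover have "Re (f x) \<le> norm x * K"
      using K[of x] complex_Re_le_cmod[of "f x"] by linarith
    ultimately show ?thesis
      by (simp add: q_def power2_eq_square algebra_simps)
  qed
  then have bdd: "bdd_below (range q)"
    by (intro bdd_belowI) auto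
  define m where "m = (INF x. q x)"
  have m_le: "m \<le> q x" for x
    unfolding m_def using bdd by (rule cINF_lower) simp
  have "\<exists>x. q x < m + 1 / real (Suc n)" for n
    using cINF_less_iff[OF _ bdd, of "m + 1 / real (Suc n)"] by (auto simp: m_def)
  then obtain v where v: "\<And>n. q (v n) < m + 1 / real (Suc n)"
    by metis
  have mid: "(norm (x - y))\<^sup>2 \<le> 2 * (q x + q y - 2 * m)" for x y
  proof -
    have "4 * m \<le> 4 * q ((1/2) *\<^sub>R (x + y))"
      using m_le by simp
    also have "\<dots> = (norm (x + y))\<^sup>2 - 4 * Re (f x) - 4 * Re (f y)"
      by (simp add: q_def scaleR add power_divide add_divide_distrib)
    finally show ?thesis
      using parallelogram[of x y] by (simp add: q_def)
  qed
  have "Cauchy v"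
  proof (rule metric_CauchyI)
    fix e :: real assume "0 < e"
    then obtain N where N: "1 / real (Suc N) < e\<^sup>2 / 4"
      using reals_Archimedean[of "e\<^sup>2 / 4"] by (auto simp: inverse_eq_divide)
    have q_less: "q (v i) < m + e\<^sup>2 / 4" if "N \<le> i" for i
    proof -
      have "1 / real (Suc i) \<le> 1 / real (Suc N)"
        using that by (auto simp: frac_le)
      also note N
      finally have "m + 1 / real (Suc i) < m + e\<^sup>2 / 4"
        by (rule add_strict_left_mono)
      with v[of i] show ?thesis by (rule less_trans)
    qed
    have "dist (v i) (v j) < e" if "N \<le> i" "N \<le> j" for i j
    proof -
      note mid[of "v i" "v j"]
      also have "2 * (q (v i) + q (v j) - 2 * m) < 2 * ((m + e\<^sup>2 / 4) + (m + e\<^sup>2 / 4) - 2 * m)"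
        by (intro mult_strict_left_mono diff_strict_right_mono add_strict_mono q_less that) simp
      also have "\<dots> = e\<^sup>2"
        by simp
      finally have "(norm (v i - v j))\<^sup>2 < e\<^sup>2" .
      then show ?thesis
        using \<open>0 < e\<close> by (simp add: dist_norm power2_less_imp_less)
    qed
    then show "\<exists>N. \<forall>i\<ge>N. \<forall>j\<ge>N. dist (v i) (v j) < e"
      by blast
  qed
  then obtain u where u: "v \<longlonglongrightarrow> u"
    using Cauchy_convergent convergent_def by blast
  have "(\<lambda>n. q (v n)) \<longlonglongrightarrow> q u"
    unfolding q_def by (intro tendsto_intros tendsto u)
  moreover have "(\<lambda>n. m + 1 / real (Suc n)) \<longlonglongrightarrow> m + 0"
    by (intro tendsto_intros LIMSEQ_Suc[OF lim_1_over_n])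
  ultimately have "q u \<le> m + 0"
    by (rule LIMSEQ_le) (use v less_imp_le in blast)
  then have min: "q u \<le> q x" for x
    using m_le[of x] by simp
  have Re_eq: "Re (cinner u h) = Re (f h)" for h
  proof (rule ccontr)
    define d where "d = Re (cinner u h) - Re (f h)"
    define N where "N = (norm h)\<^sup>2 + 1"
    have N: "N > 0" by (simp add: N_def add_nonneg_pos)
    assume "Re (cinner u h) \<noteq> Re (f h)"
    then have d: "d\<^sup>2 > 0" by (simp add: d_def)
    have "q (u + s *\<^sub>R h) = q u + 2 * s * d + s\<^sup>2 * (norm h)\<^sup>2" for s
      unfolding q_def norm_add_sqr d_def
      by (simp add: add scaleR cinner_scaleR_right power_mult_distrib algebra_simps)
    then have "q (u + (- d / N) *\<^sub>R h) = q u + 2 * (- d / N) * d + (- d / N)\<^sup>2 * (norm h)\<^sup>2" .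
    also have "(- d / N)\<^sup>2 * (norm h)\<^sup>2 \<le> (- d / N)\<^sup>2 * N"
      by (rule mult_left_mono) (auto simp: N_def)
    also have "q u + 2 * (- d / N) * d + (- d / N)\<^sup>2 * N = q u - d\<^sup>2 / N"
      using N by (simp add: power2_eq_square field_simps)
    also have "\<dots> < q u"
      using d N by simp
    finally show False
      using min[of "u + (- d / N) *\<^sub>R h"] by simp
  qed
  have "cinner u x = f x" for x
  proof (rule complex_eqI)
    show "Im (cinner u x) = Im (f x)"
      using Re_eq[of "\<i> *\<^sub>C x"] by (simp add: cinner_scaleC_right fC)
  qed (rule Re_eq)
  then show ?thesis by metis
qed

section \<open>Bounded operators\<close>

lemma bounded_linear_bop_apply: "bounded_linear (bop_apply T)"
  and bop_apply_scaleC: "bop_apply T (c *\<^sub>C x) = c *\<^sub>C bop_apply T x"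
  using bop_apply[of T] by auto

lemma bop_apply_Bop:
  assumes "bounded_linear f" "\<And>c x. f (c *\<^sub>C x) = c *\<^sub>C f x"
  shows "bop_apply (Bop f) = f"
  using assms by (simp add: Bop_inverse)

lemma bop_eqI: "S = T" if "\<And>x. bop_apply S x = bop_apply T x"
  using that by (metis bop_apply_inverse ext)

lemma norm_bop_apply_le: "norm (bop_apply T x) \<le> norm T * norm x"
  by (simp add: norm_bop.rep_eq onorm bounded_linear_bop_apply)

lemma norm_bop_le: "norm T \<le> C" if "0 \<le> C" "\<And>x. norm (bop_apply T x) \<le> C * norm x"
  unfolding norm_bop.rep_eq using that by (rule onorm_bound)

lemma bounded_bilinear_bop_apply: "bounded_bilinear bop_apply"
proof
  show "\<exists>K. \<forall>S x. norm (bop_apply S x) \<le> norm S * norm x * K"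
    using norm_bop_apply_le by (metis mult.right_neutral)
qed (simp_all add: plus_bop.rep_eq scaleR_bop.rep_eq linear_simps[OF bounded_linear_bop_apply])

lemma ex_adjoint:
  fixes T :: "'h::complex_hilbert_space bop"
  shows "\<exists>S. \<forall>x y. cinner (bop_apply T x) y = cinner x (bop_apply S y)"
proof -
  have "\<exists>u. \<forall>x. cinner y (bop_apply T x) = cinner u x" for y
    by (rule riesz_representation)
      (auto intro: bounded_linear_compose[OF bounded_linear_cinner_right bounded_linear_bop_apply]
        simp: bop_apply_scaleC cinner_scaleC_right)
  then obtain g where g: "\<And>y x. cinner y (bop_apply T x) = cinner (g y) x"
    by metis
  then have g': "cinner (bop_apply T x) y = cinner x (g y)" for x y
    by (metis cinner_commute)
  have gC: "g (c *\<^sub>C x) = c *\<^sub>C g x" for c x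
    by (rule cinner_ext) (simp add: cinner_scaleC_right flip: g')
  have "bounded_linear g"
  proof (rule bounded_linear_intro[where K = "norm T"])
    show "g (x + y) = g x + g y" for x y
      by (rule cinner_ext) (simp add: cinner_add_right flip: g')
    show "g (r *\<^sub>R x) = r *\<^sub>R g x" for r x
      by (simp add: scaleR_scaleC gC)
    show "norm (g x) \<le> norm x * norm T" for x
    proof (rule norm_le_if_cinner_le)
      fix y :: 'h assume "norm y \<le> 1"
      have "norm (cinner y (g x)) \<le> norm (bop_apply T y) * norm x"
        by (simp add: norm_cinner_le flip: g')
      also have "\<dots> \<le> (norm T * norm y) * norm x"
        by (intro mult_right_mono norm_bop_apply_le) simp
      also have "\<dots> \<le> (norm T * 1) * norm x"
        by (intro mult_right_mono mult_left_mono \<open>norm y \<le> 1\<close>) simp_all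
      finally show "norm (cinner y (g x)) \<le> norm x * norm T"
        by (simp add: mult.commute)
    qed
  qed
  then have "bop_apply (Bop g) = g"
    by (intro bop_apply_Bop gC)
  with g' show ?thesis by metis
qed

lemma adjoint_bop_eqI:
  assumes "\<And>x y. cinner (bop_apply T x) y = cinner x (bop_apply S y)"
  shows "adjoint_bop T = S"
  unfolding adjoint_bop_def
proof (rule the_equality)
  fix R assume "\<forall>x y. cinner (bop_apply T x) y = cinner x (bop_apply R y)"
  with assms show "R = S"
    by (intro bop_eqI cinner_ext) metis
qed (use assms in blast)

lemma cinner_adjoint_right: "cinner x (bop_apply (adjoint_bop T) y) = cinner (bop_apply T x) y"
  using ex_adjoint[of T] adjoint_bop_eqI by metis

lemma cinner_adjoint_left: "cinner (bop_apply (adjoint_bop T) x) y = cinner x (bop_apply T y)"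
  by (metis cinner_adjoint_right cinner_commute)

lemma adjoint_adjoint [simp]: "adjoint_bop (adjoint_bop T) = T"
  by (rule adjoint_bop_eqI) (rule cinner_adjoint_left)

lemma adjoint_minus: "adjoint_bop (- T) = - adjoint_bop T"
  by (rule adjoint_bop_eqI)
    (simp add: uminus_bop.rep_eq cinner_minus_left cinner_minus_right cinner_adjoint_right)

lemma adjoint_diff: "adjoint_bop (S - T) = adjoint_bop S - adjoint_bop T"
  by (rule adjoint_bop_eqI)
    (simp add: minus_bop.rep_eq cinner_diff_left cinner_diff_right cinner_adjoint_right)

lemma adjoint_scaleR: "adjoint_bop (r *\<^sub>R T) = r *\<^sub>R adjoint_bop T"
  by (rule adjoint_bop_eqI)
    (simp add: scaleR_bop.rep_eq cinner_scaleR_left cinner_scaleR_right cinner_adjoint_right)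

lemma adjoint_mult: "adjoint_bop (S * T) = adjoint_bop T * adjoint_bop S"
  by (rule adjoint_bop_eqI) (simp add: times_bop.rep_eq cinner_adjoint_right)

lemma norm_adjoint_le: "norm (adjoint_bop T) \<le> norm T"
proof (rule norm_bop_le, simp, rule norm_le_if_cinner_le)
  fix x y :: 'a assume "norm y \<le> 1"
  have "norm (cinner y (bop_apply (adjoint_bop T) x)) \<le> norm (bop_apply T y) * norm x"
    by (simp add: cinner_adjoint_right norm_cinner_le)
  also have "\<dots> \<le> (norm T * norm y) * norm x"
    by (intro mult_right_mono norm_bop_apply_le) simp
  also have "\<dots> \<le> (norm T * 1) * norm x"
    by (intro mult_right_mono mult_left_mono \<open>norm y \<le> 1\<close>) simp_all
  finally show "norm (cinner y (bop_apply (adjoint_bop T) x)) \<le> norm T * norm x"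
    by simp
qed

lemma norm_adjoint [simp]: "norm (adjoint_bop T) = norm T"
  using norm_adjoint_le[of T] norm_adjoint_le[of "adjoint_bop T"] by simp

lemma bounded_linear_adjoint: "bounded_linear adjoint_bop"
proof (rule bounded_linear_intro[where K = 1])
  show "adjoint_bop (S + T) = adjoint_bop S + adjoint_bop T" for S T :: "'a bop"
    using adjoint_diff[of S "- T"] by (simp add: adjoint_minus)
qed (simp_all add: adjoint_scaleR)

lift_definition id_bop :: "'h::complex_hilbert_space bop" is "\<lambda>x. x"
  by (simp add: bounded_linear_ident)

lift_definition rank1 :: "'h::complex_hilbert_space \<Rightarrow> 'h \<Rightarrow> 'h bop" is "\<lambda>x y z. cinner y z *\<^sub>C x"
proof (intro conjI allI)
  fix x y :: 'h
  show "bounded_linear (\<lambda>z. cinner y z *\<^sub>C x)"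
  proof (rule bounded_linear_intro[where K = "norm y * norm x"])
    show "cinner y (r *\<^sub>R z) *\<^sub>C x = r *\<^sub>R (cinner y z *\<^sub>C x)" for r z
      by (simp add: cinner_scaleC_right scaleR_scaleC scaleC_scaleC)
    show "norm (cinner y z *\<^sub>C x) \<le> norm z * (norm y * norm x)" for z
      using mult_right_mono[OF norm_cinner_le[of y z] norm_ge_zero[of x]]
      by (simp add: norm_scaleC mult_ac)
  qed (simp add: cinner_add_right scaleC_add_left)
qed (simp add: cinner_scaleC_right scaleC_scaleC)

lemma norm_rank1_le: "norm (rank1 x y) \<le> norm x * norm y"
proof (rule norm_bop_le)
  show "norm (bop_apply (rank1 x y) z) \<le> norm x * norm y * norm z" for z
    using mult_right_mono[OF norm_cinner_le[of y z] norm_ge_zero[of x]]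
    by (simp add: rank1.rep_eq norm_scaleC mult_ac)
qed simp

lemma rank1_add: "rank1 (x + y) z = rank1 x z + rank1 y z"
  by (rule bop_eqI) (simp add: rank1.rep_eq plus_bop.rep_eq scaleC_add_right)

lemma rank1_scaleC: "rank1 (c *\<^sub>C x) z = c *\<^sub>C rank1 x z"
  by (rule bop_eqI) (simp add: rank1.rep_eq scaleC_bop.rep_eq scaleC_scaleC mult.commute)

lemma mult_rank1: "T * rank1 x z = rank1 (bop_apply T x) z"
  by (rule bop_eqI) (simp add: rank1.rep_eq times_bop.rep_eq bop_apply_scaleC)

lemma norm_scaleC_bop: "norm (c *\<^sub>C T) = cmod c * norm T" for T :: "'h::complex_hilbert_space bop"
proof -
  have le: "norm (c *\<^sub>C T) \<le> cmod c * norm T" for c and T :: "'h bop"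
    by (rule norm_bop_le)
      (auto intro: mult_left_mono norm_bop_apply_le simp: scaleC_bop.rep_eq norm_scaleC mult.assoc)
  show ?thesis
  proof (cases "c = 0")
    case False
    then have "norm T \<le> cmod (inverse c) * norm (c *\<^sub>C T)"
      using le[of "inverse c" "c *\<^sub>C T"] by (simp add: scaleC_scaleC scaleC_one)
    with False le[of c T] show ?thesis
      by (simp add: norm_inverse norm_divide field_simps)
  qed (use le[of c T] in simp)
qed

lemma bounded_linear_scaleC_bop: "bounded_linear (\<lambda>T::'h::complex_hilbert_space bop. c *\<^sub>C T)"
  by (rule bounded_linear_intro[where K = "cmod c"])
    (simp_all add: scaleC_add_right norm_scaleC_bop mult.commute scaleR_scaleC scaleC_scaleC)

section \<open>Uniform boundedness\<close>

lemma uniform_boundedness: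
  fixes f :: "'i \<Rightarrow> 'a::{real_normed_vector, complete_space} \<Rightarrow> 'b::real_normed_vector"
  assumes lin: "\<And>i. bounded_linear (f i)"
    and bdd: "\<And>x. \<exists>C. \<forall>i. norm (f i x) \<le> C"
  shows "\<exists>M. \<forall>i x. norm (f i x) \<le> M * norm x"
proof -
  define G where "G n = {x. \<forall>i. norm (f i x) \<le> real n}" for n :: nat
  have closed: "closed (G n)" for n
    unfolding G_def
    by (intro closed_Collect_all closed_Collect_le continuous_intros
        linear_continuous_on[OF lin])
  have "(\<Union>n. G n) = UNIV"
  proof -
    have "\<exists>n. x \<in> G n" for x
    proof -
      obtain C where "\<And>i. norm (f i x) \<le> C"
        using bdd[of x] by blast
      moreover obtain n where "C \<le> real n"
        using real_arch_simple by blast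
      ultimately show ?thesis
        unfolding G_def by (blast intro: order_trans)
    qed
    then show ?thesis by auto
  qed
  moreover have "euclidean interior_of (\<Union>n. G n) = {}" if "\<And>n. interior (G n) = {}"
    by (rule Baire_category_alt) (use closed that completely_metrizable_space_euclidean in auto)
  ultimately obtain n where "interior (G n) \<noteq> {}"
    by (metis UNIV_not_empty euclidean_interior_of interior_UNIV)
  then obtain a r where r: "r > 0" "cball a r \<subseteq> G n"
    by (metis all_not_in_conv mem_interior_cball)
  have "norm (f i x) \<le> 2 * real n / r * norm x" for i x
  proof (cases "x = 0")
    case False
    interpret bounded_linear "f i" by (rule lin)
    define s where "s = r / norm x"
    have s: "s > 0" using r False by (simp add: s_def)
    have "a \<in> cball a r" "a + s *\<^sub>R x \<in> cball a r"
      using r(1) False by (auto simp: s_def dist_norm)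
    with r(2) have "a \<in> G n" "a + s *\<^sub>R x \<in> G n"
      by blast+
    then have "norm (f i a) \<le> real n" "norm (f i (a + s *\<^sub>R x)) \<le> real n"
      by (auto simp: G_def)
    then have "norm (f i (a + s *\<^sub>R x) - f i a) \<le> 2 * real n"
      using norm_triangle_ineq4[of "f i (a + s *\<^sub>R x)" "f i a"] by linarith
    then have "s * norm (f i x) \<le> 2 * real n"
      using s by (simp add: add scaleR)
    then show ?thesis
      using r False by (simp add: s_def field_simps)
  qed (simp add: linear_simps[OF lin])
  then show ?thesis by blast
qed

section \<open>The algebra \<open>C\<^sub>0(L, B(H))\<close>\<close>

lemma ex_bump:
  fixes t :: "'l::t2_space"
  assumes "locally_compact_space (euclidean :: 'l topology)"
  obtains g :: "'l \<Rightarrow> real" and K where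
    "continuous_on UNIV g" "\<And>s. 0 \<le> g s" "\<And>s. g s \<le> 1" "g t = 1" "compact K" "\<And>s. s \<notin> K \<Longrightarrow> g s = 0"
proof -
  have "Hausdorff_space (euclidean :: 'l topology)"
    unfolding Hausdorff_space_def disjnt_def using hausdorff by fastforce
  then have "completely_regular_space (euclidean :: 'l topology)"
    using assms locally_compact_regular_imp_completely_regular_space by blast
  moreover obtain U K where U: "open U" "compact K" "t \<in> U" "U \<subseteq> K"
    using assms unfolding locally_compact_space_def by (metis UNIV_I compactin_euclidean_iff open_openin topspace_euclidean)
  moreover have "closedin euclidean (- U)" "t \<in> topspace euclidean - (- U)"
    using U by (auto simp: closed_Compl)
  ultimately obtain f :: "'l \<Rightarrow> real" where f: "continuous_map euclidean (top_of_set {0..1}) f" "f t = 0" "f ` (- U) \<subseteq> {1}"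
    unfolding completely_regular_space_def by meson
  then have "continuous_on UNIV f" "\<And>s. f s \<in> {0..1}"
    by (auto simp: continuous_map_in_subtopology image_subset_iff)
  with f U show ?thesis
    by (intro that[of "\<lambda>s. 1 - f s" K]) (auto intro!: continuous_intros)
qed

lemma C0_continuous: "X \<in> C0 \<Longrightarrow> continuous_on UNIV X"
  by (simp add: C0_def)

lemma C0_bdd_above:
  assumes "X \<in> C0"
  shows "bdd_above (range (\<lambda>t. norm (X t)))"
proof -
  obtain K where K: "compact K" "\<And>t. t \<notin> K \<Longrightarrow> norm (X t) < 1"
    using assms zero_less_one unfolding C0_def by blast
  have "bounded (X ` K)"
    by (intro compact_imp_bounded compact_continuous_image K
        continuous_on_subset[OF C0_continuous[OF assms]] subset_UNIV)
  then obtain B where B: "\<And>t. t \<in> K \<Longrightarrow> norm (X t) \<le> B"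
    by (auto simp: bounded_iff)
  have "norm (X t) \<le> max B 1" for t
    using K(2)[of t] B[of t] by (cases "t \<in> K") auto
  then show ?thesis
    by (intro bdd_aboveI) auto
qed

lemma norm_le_sup_norm: "X \<in> C0 \<Longrightarrow> norm (X t) \<le> sup_norm X"
  unfolding sup_norm_def by (intro cSUP_upper C0_bdd_above) auto

lemma sup_norm_le: "sup_norm X \<le> C" if "\<And>t. norm (X t) \<le> C"
  unfolding sup_norm_def using that by (intro cSUP_least) auto

lemma C0_compact_support:
  assumes "continuous_on UNIV X" "compact K" "\<And>t. t \<notin> K \<Longrightarrow> X t = 0"
  shows "X \<in> C0"
  unfolding C0_def
proof (intro CollectI conjI allI impI)
  fix e :: real assume "0 < e"
  then show "\<exists>K. compact K \<and> (\<forall>t. t \<notin> K \<longrightarrow> norm (X t) < e)"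
    using assms by (intro exI[of _ K]) simp
qed (rule assms)

lemma C0_dominated:
  fixes h :: "real \<Rightarrow> real"
  assumes X: "X \<in> C0" and Y: "continuous_on UNIV Y"
    and le: "\<And>t. norm (Y t) \<le> h (norm (X t))" and h: "isCont h 0" "h 0 = 0"
  shows "Y \<in> C0"
  unfolding C0_def
proof (intro CollectI conjI allI impI)
  fix e :: real assume "0 < e"
  then obtain d where d: "d > 0" "\<And>r. norm r < d \<Longrightarrow> norm (h r) < e"
    using h unfolding isCont_def LIM_eq by (metis diff_zero norm_zero)
  obtain K where "compact K" "\<And>t. t \<notin> K \<Longrightarrow> norm (X t) < d"
    using X \<open>d > 0\<close> unfolding C0_def by blast
  moreover have "norm (Y t) < e" if "norm (X t) < d" for t
    using le[of t] d(2)[of "norm (X t)"] that by simp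
  ultimately show "\<exists>K. compact K \<and> (\<forall>t. t \<notin> K \<longrightarrow> norm (Y t) < e)"
    by blast
qed (rule Y)

lemma C0_bounded_linear:
  assumes "bounded_linear f" "X \<in> C0"
  shows "(\<lambda>t. f (X t)) \<in> C0"
proof -
  obtain B where "\<And>T. norm (f T) \<le> norm T * B"
    using bounded_linear.bounded[OF assms(1)] by blast
  moreover have "continuous_on UNIV (\<lambda>t. f (X t))"
    by (rule bounded_linear.continuous_on[OF assms(1) C0_continuous[OF assms(2)]])
  ultimately show ?thesis
    using C0_dominated[OF assms(2), of "\<lambda>t. f (X t)" "\<lambda>r. r * B"] by simp
qed

lemma C0_zero: "(\<lambda>t. 0) \<in> C0"
  by (rule C0_compact_support[where K = "{}"]) auto

lemma C0_add:
  assumes X: "X \<in> C0" and Y: "Y \<in> C0"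
  shows "(\<lambda>t. X t + Y t) \<in> C0"
  unfolding C0_def
proof (intro CollectI conjI allI impI)
  show "continuous_on UNIV (\<lambda>t. X t + Y t)"
    by (intro continuous_intros C0_continuous[OF X] C0_continuous[OF Y])
  fix e :: real assume "0 < e"
  then have "0 < e / 2" by simp
  then obtain K L where K: "compact K" "\<And>t. t \<notin> K \<Longrightarrow> norm (X t) < e / 2"
    and L: "compact L" "\<And>t. t \<notin> L \<Longrightarrow> norm (Y t) < e / 2"
    using X Y unfolding C0_def by blast
  have "norm (X t + Y t) < e" if "t \<notin> K \<union> L" for t
    using K(2)[of t] L(2)[of t] that norm_triangle_ineq[of "X t" "Y t"] by simp
  then show "\<exists>K. compact K \<and> (\<forall>t. t \<notin> K \<longrightarrow> norm (X t + Y t) < e)"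
    using compact_Un[OF K(1) L(1)] by blast
qed

lemma C0_scaleC: "X \<in> C0 \<Longrightarrow> (\<lambda>t. c *\<^sub>C X t) \<in> C0"
  using C0_bounded_linear[OF bounded_linear_scaleC_bop] .

lemma C0_diff: "X \<in> C0 \<Longrightarrow> Y \<in> C0 \<Longrightarrow> (\<lambda>t. X t - Y t) \<in> C0"
  using C0_add[of X "\<lambda>t. - Y t"] C0_bounded_linear[OF bounded_linear_minus[OF bounded_linear_ident], of Y]
  by simp

lemma C0_mult:
  assumes X: "X \<in> C0" and Y: "Y \<in> C0"
  shows "(\<lambda>t. X t * Y t) \<in> C0"
proof (rule C0_dominated[OF Y, where h = "\<lambda>r. sup_norm X * r"])
  show "continuous_on UNIV (\<lambda>t. X t * Y t)"
    by (intro continuous_intros C0_continuous[OF X] C0_continuous[OF Y])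
  show "norm (X t * Y t) \<le> sup_norm X * norm (Y t)" for t
    using norm_mult_ineq[of "X t" "Y t"] mult_right_mono[OF norm_le_sup_norm[OF X, of t] norm_ge_zero]
    by (rule order_trans)
qed auto

lemma C0_adjoint: "X \<in> C0 \<Longrightarrow> (\<lambda>t. adjoint_bop (X t)) \<in> C0"
  by (rule C0_bounded_linear[OF bounded_linear_adjoint])

lemma C0_uniform_limit:
  assumes X: "\<And>n. X n \<in> C0" and lim: "uniform_limit UNIV X Y sequentially"
  shows "Y \<in> C0"
  unfolding C0_def
proof (intro CollectI conjI allI impI)
  show "continuous_on UNIV Y"
    by (rule uniform_limit_theorem[OF _ lim]) (auto intro: always_eventually C0_continuous X)
  fix e :: real assume "0 < e"
  then have e: "0 < e / 2" by simp
  then obtain n where n: "\<And>t. dist (X n t) (Y t) < e / 2"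
    using uniform_limitD[OF lim e] eventually_happens[of _ sequentially] by auto
  obtain K where K: "compact K" "\<And>t. t \<notin> K \<Longrightarrow> norm (X n t) < e / 2"
    using X[of n] e unfolding C0_def by blast
  have "norm (Y t) < e" if "t \<notin> K" for t
    using K(2)[OF that] n[of t] norm_triangle_ineq2[of "Y t" "X n t"]
    by (simp add: dist_norm norm_minus_commute)
  with K(1) show "\<exists>K. compact K \<and> (\<forall>t. t \<notin> K \<longrightarrow> norm (Y t) < e)"
    by blast
qed

lemma C0_sqrt_factorization:
  fixes X :: "'l::topological_space \<Rightarrow> 'h::complex_hilbert_space bop"
  assumes X: "X \<in> C0"
  obtains Y W where "Y \<in> C0" "W \<in> C0" "X = (\<lambda>t. Y t * W t)"
    "\<And>t. X t = 0 \<Longrightarrow> Y t = 0" "\<And>t. X t = 0 \<Longrightarrow> W t = 0"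
proof -
  let ?Y = "\<lambda>t. sqrt (norm (X t)) *\<^sub>R (id_bop :: 'h bop)"
  define g :: "'h bop \<Rightarrow> 'h bop" where "g T = inverse (sqrt (norm T)) *\<^sub>R T" for T
  have norm_g: "norm (g T) = sqrt (norm T)" for T
    by (cases "T = 0") (simp_all add: g_def real_div_sqrt divide_inverse[symmetric] mult.commute)
  have cont_g: "isCont g T" for T
  proof (cases "T = 0")
    case True
    have "((\<lambda>S. norm (g S)) \<longlongrightarrow> sqrt (norm T)) (at T)"
      unfolding norm_g by (intro tendsto_intros)
    with True show ?thesis
      by (simp add: isCont_def g_def[of 0] tendsto_norm_zero_iff)
  next
    case False
    then show ?thesis
      unfolding g_def by (intro continuous_intros) auto
  qed
  have norm_id: "norm (id_bop :: 'h bop) \<le> 1"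
    by (rule norm_bop_le) (simp_all add: id_bop.rep_eq)
  have Y: "?Y \<in> C0"
  proof (rule C0_dominated[OF X, where h = sqrt])
    show "norm (?Y t) \<le> sqrt (norm (X t))" for t
      using mult_left_mono[OF norm_id, of "sqrt (norm (X t))"] by simp
  qed (auto intro!: continuous_intros C0_continuous[OF X])
  have W: "(\<lambda>t. g (X t)) \<in> C0"
  proof (rule C0_dominated[OF X, where h = sqrt])
    show "continuous_on UNIV (\<lambda>t. g (X t))"
      by (rule continuous_on_compose2[OF continuous_at_imp_continuous_on C0_continuous[OF X]])
        (use cont_g in auto)
  qed (auto intro!: continuous_intros simp: norm_g)
  have eq: "X = (\<lambda>t. ?Y t * g (X t))"
  proof
    fix t
    have "id_bop * T = T" for T :: "'h bop"
      by (rule bop_eqI) (simp add: times_bop.rep_eq id_bop.rep_eq)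
    then show "X t = ?Y t * g (X t)"
      by (cases "X t = 0") (simp_all add: g_def)
  qed
  show ?thesis
    by (rule that[OF Y W eq]) (simp_all add: g_def)
qed

lemma continuous_map_ultraweak:
  fixes Z :: "'l::topological_space \<Rightarrow> 'h::complex_hilbert_space bop"
  assumes bdd: "\<And>t. norm (Z t) \<le> M"
    and cont: "\<And>x y. continuous_on UNIV (\<lambda>t. cinner x (bop_apply (Z t) y))"
  shows "continuous_map euclidean ultraweak_topology Z"
  unfolding ultraweak_topology_def
proof (rule continuous_on_generated_topo)
  have "continuous_on UNIV (\<lambda>t. \<phi> (Z t))" if predual: "\<phi> \<in> bop_predual" for \<phi>
  proof -
    obtain x y :: "nat \<Rightarrow> 'h" where \<phi>: "\<phi> = (\<lambda>T. \<Sum>n. cinner (x n) (bop_apply T (y n)))"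
      and sx: "summable (\<lambda>n. (norm (x n))\<^sup>2)" and sy: "summable (\<lambda>n. (norm (y n))\<^sup>2)"
      using predual by (auto simp: bop_predual_def)
    have "norm (cinner (x n) (bop_apply (Z t) (y n))) \<le> M * ((norm (x n))\<^sup>2 + (norm (y n))\<^sup>2)" for n t
    proof -
      have "norm (cinner (x n) (bop_apply (Z t) (y n))) \<le> norm (x n) * (norm (Z t) * norm (y n))"
        by (rule order_trans[OF norm_cinner_le]) (intro mult_left_mono norm_bop_apply_le norm_ge_zero)
      also have "\<dots> \<le> norm (x n) * (M * norm (y n))"
        by (intro mult_left_mono mult_right_mono bdd norm_ge_zero)
      also have "\<dots> = M * (norm (x n) * norm (y n))"
        by simp
      also have "\<dots> \<le> M * ((norm (x n))\<^sup>2 + (norm (y n))\<^sup>2)"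
      proof (rule mult_left_mono)
        have "0 \<le> norm (x n) * norm (y n)"
          by simp
        then show "norm (x n) * norm (y n) \<le> (norm (x n))\<^sup>2 + (norm (y n))\<^sup>2"
          using sum_squares_bound[of "norm (x n)" "norm (y n)"] by linarith
        show "0 \<le> M"
          using bdd[of t] norm_ge_zero order_trans by blast
      qed
      finally show ?thesis .
    qed
    moreover have "summable (\<lambda>n. M * ((norm (x n))\<^sup>2 + (norm (y n))\<^sup>2))"
      by (intro summable_mult summable_add sx sy)
    ultimately have "uniform_limit UNIV (\<lambda>n t. \<Sum>i<n. cinner (x i) (bop_apply (Z t) (y i))) (\<lambda>t. \<phi> (Z t)) sequentially"
      unfolding \<phi> by (rule Weierstrass_m_test)
    then show ?thesis
      by (rule uniform_limit_theorem[rotated]) (auto intro!: always_eventually continuous_on_sum cont)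
  qed
  then have "open ((\<lambda>t. \<phi> (Z t)) -` V)" if "\<phi> \<in> bop_predual" "open V" for \<phi> V
    using that by (intro open_vimage) auto
  then show "openin euclidean (Z -` U \<inter> topspace euclidean)"
    if "U \<in> {\<phi> -` V | \<phi> V. \<phi> \<in> bop_predual \<and> open V}" for U
    using that by (auto simp: vimage_def)
  have "(\<lambda>T. 0) \<in> (bop_predual :: ('h bop \<Rightarrow> complex) set)"
    unfolding bop_predual_def by (intro CollectI exI[of _ "\<lambda>n. 0"]) simp
  then have "UNIV \<in> {\<phi> -` V | \<phi> V. \<phi> \<in> (bop_predual :: ('h bop \<Rightarrow> complex) set) \<and> open V}"
    by (intro CollectI exI[of _ "\<lambda>T. 0"] exI[of _ UNIV]) auto
  then show "Z ` topspace euclidean \<subseteq> \<Union>{\<phi> -` V | \<phi> V. \<phi> \<in> bop_predual \<and> open V}"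
    by blast
qed

section \<open>Derivations\<close>

locale C0_derivation =
  fixes D :: "('l::t2_space \<Rightarrow> 'h::complex_hilbert_space bop) \<Rightarrow> ('l \<Rightarrow> 'h bop)"
    and \<xi> :: 'h
  assumes lc: "locally_compact_space (euclidean :: 'l topology)"
    and deriv: "derivation_C0 D"
    and norm_\<xi>: "norm \<xi> = 1"
begin

lemma D_C0: "X \<in> C0 \<Longrightarrow> D X \<in> C0"
  and D_add: "X \<in> C0 \<Longrightarrow> Y \<in> C0 \<Longrightarrow> D (\<lambda>t. X t + Y t) = (\<lambda>t. D X t + D Y t)"
  and D_scaleC: "X \<in> C0 \<Longrightarrow> D (\<lambda>t. c *\<^sub>C X t) = (\<lambda>t. c *\<^sub>C D X t)"
  and D_mult: "X \<in> C0 \<Longrightarrow> Y \<in> C0 \<Longrightarrow> D (\<lambda>t. X t * Y t) = (\<lambda>t. D X t * Y t + X t * D Y t)"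
  using deriv unfolding derivation_C0_def by blast+

lemma D_eq_0:
  assumes X: "X \<in> C0" and "X t = 0"
  shows "D X t = 0"
proof (rule C0_sqrt_factorization[OF X])
  fix Y W
  assume YW: "Y \<in> C0" "W \<in> C0" and X_eq: "X = (\<lambda>t. Y t * W t)"
    and "\<And>t. X t = 0 \<Longrightarrow> Y t = 0" "\<And>t. X t = 0 \<Longrightarrow> W t = 0"
  then have "Y t = 0" "W t = 0"
    using \<open>X t = 0\<close> by blast+
  then show ?thesis
    unfolding X_eq D_mult[OF YW] by simp
qed

lemma D_local:
  assumes X: "X \<in> C0" and Y: "Y \<in> C0" and eq: "X t = Y t"
  shows "D X t = D Y t"
proof -
  have "D (\<lambda>s. X s - Y s) t = 0"
    using eq by (intro D_eq_0 C0_diff X Y) simp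
  moreover have "D (\<lambda>s. (X s - Y s) + Y s) = (\<lambda>s. D (\<lambda>s. X s - Y s) s + D Y s)"
    by (rule D_add[OF C0_diff[OF X Y] Y])
  ultimately show ?thesis
    by (simp add: fun_eq_iff)
qed

lemma ex_extension:
  fixes t :: 'l
  shows "\<exists>X\<in>C0. X t = T \<and> (\<forall>s. norm (X s) \<le> norm T)"
proof -
  obtain g :: "'l \<Rightarrow> real" and K where g: "continuous_on UNIV g" "\<And>s. 0 \<le> g s" "\<And>s. g s \<le> 1"
    "g t = 1" "compact K" "\<And>s. s \<notin> K \<Longrightarrow> g s = 0"
    using ex_bump[OF lc, of t] by metis
  have "(\<lambda>s. g s *\<^sub>R T) \<in> C0"
    by (rule C0_compact_support[where K = K]) (auto intro!: continuous_intros g)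
  moreover have "norm (g s *\<^sub>R T) \<le> norm T" for s
    using g(2,3)[of s] by (simp add: mult_left_le_one_le)
  ultimately show ?thesis
    using g(4) by (intro bexI[of _ "\<lambda>s. g s *\<^sub>R T"]) auto
qed

definition extension :: "'l \<Rightarrow> 'h bop \<Rightarrow> 'l \<Rightarrow> 'h bop"
  where "extension t T = (SOME X. X \<in> C0 \<and> X t = T \<and> (\<forall>s. norm (X s) \<le> norm T))"

lemma extension_C0: "extension t T \<in> C0"
  and extension_at: "extension t T t = T"
  and norm_extension_le: "norm (extension t T s) \<le> norm T"
  using someI_ex[of "\<lambda>X. X \<in> C0 \<and> X t = T \<and> (\<forall>s. norm (X s) \<le> norm T)"] ex_extension[of t T]
  unfolding extension_def by blast+

definition z :: "'l \<Rightarrow> 'h \<Rightarrow> 'h"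
  where "z t x = bop_apply (D (extension t (rank1 x \<xi>)) t) \<xi>"

lemma z_eqI:
  assumes "X \<in> C0" "X t = rank1 x \<xi>"
  shows "z t x = bop_apply (D X t) \<xi>"
  unfolding z_def using D_local[OF assms(1) extension_C0[of t "rank1 x \<xi>"], of t] assms(2) extension_at
  by simp

lemma z_add: "z t (x + y) = z t x + z t y"
proof -
  let ?X = "extension t (rank1 x \<xi>)" and ?Y = "extension t (rank1 y \<xi>)"
  have "z t (x + y) = bop_apply (D (\<lambda>s. ?X s + ?Y s) t) \<xi>"
    by (intro z_eqI C0_add extension_C0) (simp add: extension_at rank1_add)
  then show ?thesis
    by (simp add: D_add extension_C0 plus_bop.rep_eq z_def)
qed

lemma z_scaleC: "z t (c *\<^sub>C x) = c *\<^sub>C z t x"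
proof -
  let ?X = "extension t (rank1 x \<xi>)"
  have "z t (c *\<^sub>C x) = bop_apply (D (\<lambda>s. c *\<^sub>C ?X s) t) \<xi>"
    by (intro z_eqI C0_scaleC extension_C0) (simp add: extension_at rank1_scaleC)
  then show ?thesis
    by (simp add: D_scaleC extension_C0 scaleC_bop.rep_eq z_def)
qed

lemma z_scaleR: "z t (r *\<^sub>R x) = r *\<^sub>R z t x"
  by (simp add: scaleR_scaleC z_scaleC)

lemma z_apply:
  assumes X: "X \<in> C0"
  shows "z t (bop_apply (X t) x) = bop_apply (D X t) x + bop_apply (X t) (z t x)"
proof -
  let ?Y = "extension t (rank1 x \<xi>)"
  have "z t (bop_apply (X t) x) = bop_apply (D (\<lambda>s. X s * ?Y s) t) \<xi>"
    by (intro z_eqI C0_mult X extension_C0) (simp add: extension_at mult_rank1)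
  also have "\<dots> = bop_apply (D X t) (bop_apply (rank1 x \<xi>) \<xi>) + bop_apply (X t) (z t x)"
    by (simp add: D_mult X extension_C0 extension_at plus_bop.rep_eq times_bop.rep_eq z_def)
  also have "bop_apply (rank1 x \<xi>) \<xi> = x"
    by (simp add: rank1.rep_eq cinner_self norm_\<xi> scaleC_one)
  finally show ?thesis .
qed

text \<open>Evaluating the derivation identity at \<open>\<xi> \<otimes> y\<^sup>*\<close> expresses \<open>\<langle>y, z t w\<rangle>\<close> through bounded operators.\<close>

lemma bounded_linear_cinner_z: "bounded_linear (\<lambda>w. cinner y (z t w))"
proof -
  let ?X = "extension t (rank1 \<xi> y)"
  have "cinner y (z t w) = cinner y w * cinner \<xi> (z t \<xi>) - cinner \<xi> (bop_apply (D ?X t) w)" for w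
  proof -
    have "cinner y w *\<^sub>C z t \<xi> = bop_apply (D ?X t) w + cinner y (z t w) *\<^sub>C \<xi>"
      using z_apply[OF extension_C0[of t "rank1 \<xi> y"], of t w]
      by (simp add: extension_at rank1.rep_eq z_scaleC)
    then have "cinner \<xi> (cinner y w *\<^sub>C z t \<xi>) = cinner \<xi> (bop_apply (D ?X t) w + cinner y (z t w) *\<^sub>C \<xi>)"
      by simp
    then show ?thesis
      by (simp add: cinner_add_right cinner_scaleC_right cinner_self norm_\<xi>)
  qed
  moreover have "bounded_linear (\<lambda>w. cinner y w * cinner \<xi> (z t \<xi>) - cinner \<xi> (bop_apply (D ?X t) w))"
    by (intro bounded_linear_sub bounded_linear_mult_const
        bounded_linear_compose[OF bounded_linear_cinner_right bounded_linear_bop_apply]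
        bounded_linear_cinner_right)
  ultimately show ?thesis
    by presburger
qed

text \<open>If \<open>\<parallel>z (t n) x\<parallel> > 4\<^sup>n\<close> with bumps \<open>g n\<close> at \<open>t n\<close>, then \<open>D\<close> maps \<open>(\<Sum>n. 2\<^sup>-\<^sup>n g n) x \<otimes> \<xi>\<^sup>*\<close>
  to an unbounded function.\<close>

lemma bounded_z: "\<exists>C. \<forall>t. norm (z t x) \<le> C"
proof (rule ccontr)
  assume "\<not> ?thesis"
  then have "\<forall>n::nat. \<exists>t. 4 ^ n < norm (z t x)"
    by (meson not_le)
  then obtain t where t: "\<And>n::nat. 4 ^ n < norm (z (t n) x)"
    by metis
  have "\<exists>g::'l \<Rightarrow> real. \<exists>K. continuous_on UNIV g \<and> (\<forall>s. 0 \<le> g s \<and> g s \<le> 1) \<and> g (t n) = 1 \<and> compact K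
      \<and> (\<forall>s. s \<notin> K \<longrightarrow> g s = 0)" for n
    using ex_bump[OF lc, of "t n"] by metis
  then obtain g :: "nat \<Rightarrow> 'l \<Rightarrow> real" and K where
    g: "\<And>n. continuous_on UNIV (g n)" "\<And>n s. 0 \<le> g n s" "\<And>n s. g n s \<le> 1" "\<And>n. g n (t n) = 1"
    and K: "\<And>n. compact (K n)" "\<And>n s. s \<notin> K n \<Longrightarrow> g n s = 0"
    by metis
  define h where "h n s = (1/2) ^ n * g n s" for n s
  have h: "0 \<le> h n s" "h n s \<le> (1/2) ^ n" for n s
    using g(2,3)[of n s] by (auto simp: h_def mult_left_le)
  have geometric: "summable (\<lambda>n. (1/2) ^ n :: real)"
    by (rule summable_geometric) simp
  have summable_h: "summable (\<lambda>n. h n s)" for s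
    by (rule summable_comparison_test'[OF geometric]) (use h in auto)
  define f where "f s = (\<Sum>n. h n s)" for s
  have f_ge: "(1/2) ^ n \<le> f (t n)" for n
    using sum_le_suminf[OF summable_h, of "{n}" "t n"] h g(4)[of n] by (simp add: f_def h_def)
  have f_pos: "0 < f (t n)" for n
    by (rule less_le_trans[OF _ f_ge]) simp
  have "uniform_limit UNIV (\<lambda>N s. \<Sum>n<N. h n s) f sequentially"
    unfolding f_def by (rule Weierstrass_m_test[OF _ geometric]) (use h in auto)
  then have "uniform_limit UNIV (\<lambda>N s. (\<Sum>n<N. h n s) *\<^sub>R rank1 x \<xi>) (\<lambda>s. f s *\<^sub>R rank1 x \<xi>) sequentially"
    by (rule bounded_linear.uniform_limit[OF bounded_linear_scaleR_left])
  moreover have "(\<lambda>s. (\<Sum>n<N. h n s) *\<^sub>R rank1 x \<xi>) \<in> C0" for N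
  proof (rule C0_compact_support)
    show "compact (\<Union>n<N. K n)"
      by (intro compact_UN K) simp
    show "(\<Sum>n<N. h n s) *\<^sub>R rank1 x \<xi> = 0" if "s \<notin> (\<Union>n<N. K n)" for s
      using that by (auto simp: h_def intro!: sum.neutral K)
  qed (auto simp: h_def intro!: continuous_intros g)
  ultimately have F: "(\<lambda>s. f s *\<^sub>R rank1 x \<xi>) \<in> C0"
    by (rule C0_uniform_limit[rotated])
  let ?B = "sup_norm (D (\<lambda>s. f s *\<^sub>R rank1 x \<xi>))"
  have "2 ^ n \<le> ?B" for n
  proof -
    have "(2::real) ^ n = (1/2) ^ n * 4 ^ n"
      by (simp flip: power_mult_distrib)
    also have "\<dots> \<le> f (t n) * norm (z (t n) x)"
      by (intro mult_mono f_ge less_imp_le t) (simp_all add: f_pos less_imp_le)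
    also have "\<dots> = norm (z (t n) (f (t n) *\<^sub>R x))"
      by (simp add: z_scaleR f_pos less_imp_le)
    also have "\<dots> = norm (bop_apply (D (\<lambda>s. f s *\<^sub>R rank1 x \<xi>) (t n)) \<xi>)"
      by (subst z_eqI[OF F]) (simp_all add: scaleR_scaleC rank1_scaleC)
    also have "\<dots> \<le> norm (D (\<lambda>s. f s *\<^sub>R rank1 x \<xi>) (t n))"
      using norm_bop_apply_le[of _ \<xi>] by (simp add: norm_\<xi>)
    also have "\<dots> \<le> ?B"
      by (intro norm_le_sup_norm D_C0 F)
    finally show ?thesis .
  qed
  moreover obtain n where "?B < 2 ^ n"
    using real_arch_pow[of 2 ?B] by auto
  ultimately show False
    by (meson not_le)
qed

lemma z_le: "\<exists>M. \<forall>t x. norm (z t x) \<le> M * norm x"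
proof -
  \<comment> \<open>\<open>z t\<close> is only known to be weakly bounded, so the uniform boundedness principle is applied to
    the functionals \<open>\<langle>y, z t \<cdot>\<rangle>\<close> with \<open>\<parallel>y\<parallel> \<le> 1\<close>.\<close>
  define F where "F i w = (if norm (snd i) \<le> 1 then cinner (snd i) (z (fst i) w) else 0)"
    for i :: "'l \<times> 'h" and w
  have "bounded_linear (F i)" for i
    using bounded_linear_cinner_z[of "snd i" "fst i"]
    by (cases "norm (snd i) \<le> 1") (simp_all add: F_def[abs_def] bounded_linear_zero)
  moreover have "\<exists>C. \<forall>i. norm (F i w) \<le> C" for w
  proof -
    obtain C where C: "\<And>t. norm (z t w) \<le> C"
      using bounded_z by blast
    then have "0 \<le> C"
      using norm_ge_zero order_trans by blast
    have "norm (cinner y (z t w)) \<le> C" if "norm y \<le> 1" for y t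
      using norm_cinner_le[of y "z t w"] mult_mono[OF that C[of t]] by simp
    with \<open>0 \<le> C\<close> have "norm (F i w) \<le> C" for i
      by (simp add: F_def)
    then show ?thesis by blast
  qed
  ultimately obtain M where M: "\<And>i w. norm (F i w) \<le> M * norm w"
    using uniform_boundedness by metis
  have "norm (z t w) \<le> M * norm w" for t w
  proof (rule norm_le_if_cinner_le)
    fix y :: 'h assume "norm y \<le> 1"
    with M[of "(t, y)" w] show "norm (cinner y (z t w)) \<le> M * norm w"
      by (simp add: F_def)
  qed
  then show ?thesis by blast
qed

definition Z :: "'l \<Rightarrow> 'h bop"
  where "Z t = Bop (z t)"

lemma Z_apply: "bop_apply (Z t) = z t"
  unfolding Z_def
proof (rule bop_apply_Bop)
  obtain M where "\<And>x. norm (z t x) \<le> M * norm x"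
    using z_le by blast
  then show "bounded_linear (z t)"
    by (intro bounded_linear_intro[where K = M]) (simp_all add: z_add z_scaleR mult.commute)
qed (rule z_scaleC)

lemma D_eq_commutator: "X \<in> C0 \<Longrightarrow> D X t = Z t * X t - X t * Z t"
  by (rule bop_eqI) (simp add: minus_bop.rep_eq times_bop.rep_eq Z_apply z_apply)

lemma sup_norm_D_le:
  assumes X: "X \<in> C0" and le: "sup_norm X \<le> 1"
  shows "sup_norm (D X) \<le> op_norm_C0 D"
proof -
  obtain M where M: "\<And>t x. norm (z t x) \<le> M * norm x"
    using z_le by blast
  then have "0 \<le> M"
    using order_trans[OF norm_ge_zero M[of _ \<xi>]] by (simp add: norm_\<xi>)
  then have Z_le: "norm (Z t) \<le> M" for t
    by (rule norm_bop_le) (simp add: Z_apply M)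
  have "sup_norm (D Y) \<le> M + M" if Y: "Y \<in> C0" "sup_norm Y \<le> 1" for Y
  proof (rule sup_norm_le)
    fix t
    have Y_le: "norm (Y t) \<le> 1"
      using norm_le_sup_norm[OF Y(1), of t] Y(2) by linarith
    have "norm (Z t * Y t) \<le> M" "norm (Y t * Z t) \<le> M"
      using order_trans[OF norm_mult_ineq mult_mono[OF Z_le Y_le]]
        order_trans[OF norm_mult_ineq mult_mono[OF Y_le Z_le]] \<open>0 \<le> M\<close> by simp_all
    then show "norm (D Y t) \<le> M + M"
      using norm_triangle_ineq4[of "Z t * Y t" "Y t * Z t"]
      by (simp add: D_eq_commutator[OF Y(1)])
  qed
  then have "bdd_above ((\<lambda>X. sup_norm (D X)) ` {X \<in> C0. sup_norm X \<le> 1})"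
    by (intro bdd_aboveI[where M = "M + M"]) auto
  then show ?thesis
    unfolding op_norm_C0_def using X le by (intro cSUP_upper) auto
qed

lemma op_norm_nonneg: "0 \<le> op_norm_C0 D"
proof -
  have "0 \<le> sup_norm (D (\<lambda>t. 0))"
    using norm_le_sup_norm[OF D_C0[OF C0_zero], of undefined] norm_ge_zero order_trans by blast
  also have "\<dots> \<le> op_norm_C0 D"
    by (rule sup_norm_D_le[OF C0_zero]) (rule sup_norm_le, simp)
  finally show ?thesis .
qed

lemma norm_Z_le: "norm (Z t) \<le> op_norm_C0 D"
proof (rule norm_bop_le[OF op_norm_nonneg])
  fix x :: 'h
  have unit: "norm (z t y) \<le> op_norm_C0 D" if "norm y = 1" for y
  proof -
    let ?X = "extension t (rank1 y \<xi>)"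
    have "norm (rank1 y \<xi>) \<le> 1"
      using norm_rank1_le[of y \<xi>] that by (simp add: norm_\<xi>)
    then have "sup_norm ?X \<le> 1"
      by (intro sup_norm_le order_trans[OF norm_extension_le])
    have "norm (z t y) \<le> norm (D ?X t)"
      using norm_bop_apply_le[of "D ?X t" \<xi>] by (simp add: z_def norm_\<xi>)
    also have "\<dots> \<le> sup_norm (D ?X)"
      by (intro norm_le_sup_norm D_C0 extension_C0)
    also have "\<dots> \<le> op_norm_C0 D"
      by (rule sup_norm_D_le) (fact extension_C0, fact)
    finally show ?thesis .
  qed
  show "norm (bop_apply (Z t) x) \<le> op_norm_C0 D * norm x"
  proof (cases "x = 0")
    case False
    then have "norm (z t (inverse (norm x) *\<^sub>R x)) \<le> op_norm_C0 D"
      by (intro unit) simp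
    with False show ?thesis
      by (simp add: z_scaleR Z_apply field_simps)
  qed (simp add: linear_simps[OF bounded_linear_bop_apply])
qed

lemma continuous_Z: "continuous_on UNIV (\<lambda>t. bop_apply (Z t) x)"
proof (rule continuous_at_imp_continuous_on, rule ballI)
  fix t
  obtain g :: "'l \<Rightarrow> real" and K where g: "continuous_on UNIV g" "g t = 1"
    "compact K" "\<And>s. s \<notin> K \<Longrightarrow> g s = 0"
    using ex_bump[OF lc, of t] by metis
  let ?X = "\<lambda>s. g s *\<^sub>R rank1 x \<xi>"
  have X: "?X \<in> C0"
    by (rule C0_compact_support[where K = K]) (auto intro!: continuous_intros g)
  have z_eq: "z s x = inverse (g s) *\<^sub>R bop_apply (D ?X s) \<xi>" if "g s \<noteq> 0" for s
  proof -
    have "g s *\<^sub>R z s x = bop_apply (D ?X s) \<xi>"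
      unfolding z_scaleR[symmetric] by (rule z_eqI[OF X]) (simp add: scaleR_scaleC rank1_scaleC)
    from this[symmetric] that show ?thesis by simp
  qed
  have "isCont g t" "isCont (D ?X) t"
    using g(1) C0_continuous[OF D_C0[OF X]] by (auto simp: continuous_on_eq_continuous_at)
  then have "isCont (\<lambda>s. inverse (g s) *\<^sub>R bop_apply (D ?X s) \<xi>) t"
    using g(2) by (intro continuous_intros bounded_bilinear.continuous[OF bounded_bilinear_bop_apply]) auto
  moreover have "\<forall>\<^sub>F s in nhds t. g s \<noteq> 0"
    using \<open>isCont g t\<close> unfolding isCont_def tendsto_at_iff_tendsto_nhds
    by (rule tendsto_imp_eventually_ne) (simp add: g(2))
  then have "\<forall>\<^sub>F s in nhds t. z s x = inverse (g s) *\<^sub>R bop_apply (D ?X s) \<xi>"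
    by (rule eventually_mono) (rule z_eq)
  ultimately show "isCont (\<lambda>s. bop_apply (Z s) x) t"
    unfolding Z_apply by (simp add: isCont_cong)
qed

lemma bounded_Z: "bounded (range Z)"
  by (rule boundedI[of _ "op_norm_C0 D"]) (use norm_Z_le in auto)

lemma commutator_adjoint_Z:
  assumes star: "star_derivation_C0 D" and X: "X \<in> C0"
  shows "D X t = X t * adjoint_bop (Z t) - adjoint_bop (Z t) * X t"
proof -
  let ?Y = "\<lambda>t. adjoint_bop (X t)"
  have Y: "?Y \<in> C0"
    by (rule C0_adjoint[OF X])
  have "D (\<lambda>t. adjoint_bop (?Y t)) = (\<lambda>t. adjoint_bop (D ?Y t))"
    using star[unfolded star_derivation_C0_def, THEN conjunct2, rule_format, OF Y] .
  then have "D X t = adjoint_bop (D ?Y t)"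
    by simp
  also have "\<dots> = X t * adjoint_bop (Z t) - adjoint_bop (Z t) * X t"
    by (simp add: D_eq_commutator[OF Y] adjoint_diff adjoint_mult)
  finally show ?thesis .
qed

end

theorem theorem3p8:
  fixes D :: "('l::t2_space \<Rightarrow> 'h::complex_hilbert_space bop) \<Rightarrow> ('l \<Rightarrow> 'h bop)"
  assumes "locally_compact_space (euclidean :: 'l topology)"
  shows "(star_derivation_C0 D \<longrightarrow>
      (\<exists>Z\<^sub>0 :: 'l \<Rightarrow> 'h bop.
        bounded (range Z\<^sub>0) \<and>
        continuous_map euclidean ultraweak_topology Z\<^sub>0 \<and>
        sup_norm Z\<^sub>0 \<le> op_norm_C0 D \<and>
        (\<forall>t. adjoint_bop (Z\<^sub>0 t) = - Z\<^sub>0 t) \<and>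
        (\<forall>X\<in>C0. D X = (\<lambda>t. Z\<^sub>0 t * X t - X t * Z\<^sub>0 t)))) \<and>
    (derivation_C0 D \<longrightarrow>
      (\<exists>Z\<^sub>0 :: 'l \<Rightarrow> 'h bop.
        bounded (range Z\<^sub>0) \<and>
        continuous_map euclidean ultraweak_topology Z\<^sub>0 \<and>
        sup_norm Z\<^sub>0 \<le> 2 * op_norm_C0 D \<and>
        (\<forall>X\<in>C0. D X = (\<lambda>t. Z\<^sub>0 t * X t - X t * Z\<^sub>0 t))))"
proof (cases "\<exists>x::'h. x \<noteq> 0")
  case False
  then have all_eq: "S = T" for S T :: "'h bop"
    by (metis bop_eqI)
  then have norm_0: "norm T = 0" for T :: "'h bop"
    using norm_zero by metis
  have sup: "sup_norm X = 0" for X :: "'l \<Rightarrow> 'h bop"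
    unfolding sup_norm_def norm_0 by simp
  have "{X :: 'l \<Rightarrow> 'h bop. X \<in> C0 \<and> (0::real) \<le> 1} \<noteq> {}"
    using C0_zero by auto
  then have op: "op_norm_C0 D = 0"
    unfolding op_norm_C0_def sup by (rule cSUP_const)
  have "continuous_map euclidean ultraweak_topology (\<lambda>t::'l. 0 :: 'h bop)"
    by (rule continuous_map_ultraweak[where M = 0]) (simp_all add: zero_bop.rep_eq)
  then show ?thesis
    by (intro conjI impI exI[of _ "\<lambda>t. 0"]) (auto simp: sup op intro: all_eq)
next
  case True
  then obtain x :: 'h where "x \<noteq> 0" by blast
  show ?thesis
  proof (intro conjI impI)
    assume star: "star_derivation_C0 D"
    then interpret C0_derivation D "inverse (norm x) *\<^sub>R x"
      by unfold_locales (simp_all add: assms star_derivation_C0_def \<open>x \<noteq> 0\<close>)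
    define W where "W t = (1/2) *\<^sub>R (Z t - adjoint_bop (Z t))" for t
    have norm_W: "norm (W t) \<le> op_norm_C0 D" for t
      using norm_triangle_ineq4[of "Z t" "adjoint_bop (Z t)"] norm_Z_le[of t] by (simp add: W_def)
    have "continuous_map euclidean ultraweak_topology W"
    proof (rule continuous_map_ultraweak[OF norm_W])
      fix u v :: 'h
      have "cinner u (bop_apply (W t) v)
          = (1/2) * (cinner u (bop_apply (Z t) v) - cinner (bop_apply (Z t) u) v)" for t
        by (simp add: W_def scaleR_bop.rep_eq minus_bop.rep_eq cinner_scaleR_right cinner_diff_right
            cinner_adjoint_right)
      then show "continuous_on UNIV (\<lambda>t. cinner u (bop_apply (W t) v))"
        by (simp only:)
          (intro continuous_intros continuous_Z
            bounded_linear.continuous_on[OF bounded_linear_cinner_right]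
            bounded_linear.continuous_on[OF bounded_linear_cinner_left])
    qed
    moreover have "bounded (range W)"
      by (rule boundedI[of _ "op_norm_C0 D"]) (use norm_W in auto)
    moreover have "sup_norm W \<le> op_norm_C0 D"
      by (rule sup_norm_le[OF norm_W])
    moreover have "adjoint_bop (W t) = - W t" for t
      by (simp add: W_def adjoint_scaleR adjoint_diff flip: scaleR_minus_right)
    moreover have "D X = (\<lambda>t. W t * X t - X t * W t)" if X: "X \<in> C0" for X
    proof
      fix t
      have "W t * X t - X t * W t = (1/2) *\<^sub>R ((Z t * X t - X t * Z t)
          + (X t * adjoint_bop (Z t) - adjoint_bop (Z t) * X t))"
        by (simp add: W_def algebra_simps)
      also have "\<dots> = (1/2) *\<^sub>R (D X t + D X t)"
        by (simp only: D_eq_commutator[OF X, symmetric] commutator_adjoint_Z[OF star X, symmetric])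
      finally show "D X t = W t * X t - X t * W t"
        by (simp flip: scaleR_2)
    qed
    ultimately show "\<exists>Z\<^sub>0. bounded (range Z\<^sub>0) \<and> continuous_map euclidean ultraweak_topology Z\<^sub>0 \<and>
        sup_norm Z\<^sub>0 \<le> op_norm_C0 D \<and> (\<forall>t. adjoint_bop (Z\<^sub>0 t) = - Z\<^sub>0 t) \<and>
        (\<forall>X\<in>C0. D X = (\<lambda>t. Z\<^sub>0 t * X t - X t * Z\<^sub>0 t))"
      by blast
  next
    assume "derivation_C0 D"
    then interpret C0_derivation D "inverse (norm x) *\<^sub>R x"
      by unfold_locales (simp_all add: assms \<open>x \<noteq> 0\<close>)
    have "continuous_map euclidean ultraweak_topology Z"
      by (rule continuous_map_ultraweak[OF norm_Z_le])
        (rule bounded_linear.continuous_on[OF bounded_linear_cinner_right continuous_Z])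
    moreover have "sup_norm Z \<le> 2 * op_norm_C0 D"
      using sup_norm_le[of Z, OF norm_Z_le] op_norm_nonneg by linarith
    ultimately show "\<exists>Z\<^sub>0. bounded (range Z\<^sub>0) \<and> continuous_map euclidean ultraweak_topology Z\<^sub>0 \<and>
        sup_norm Z\<^sub>0 \<le> 2 * op_norm_C0 D \<and> (\<forall>X\<in>C0. D X = (\<lambda>t. Z\<^sub>0 t * X t - X t * Z\<^sub>0 t))"
      using bounded_Z D_eq_commutator by blast
  qed
qed

end
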